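(* Every orthogonal gate is linear: if $G$ is a permutation of $\{0,1\}^n$ such that $G(x)\cdot G(y)\equiv x\cdot y\pmod 2$ for all $x,y\in\{0,1\}^n$, then $G$ is linear over $\mathbb{F}_2$, i.e. $G(x)=Ax$ for some invertible $A\in\mathbb{F}_2^{n\times n}$.
   Context: $x\cdot y=x_1y_1+\cdots+x_ny_n$ (an integer); $\{0,1\}^n$ is identified with $\mathbb{F}_2^n$. *)

theory Defs
  imports "HOL-Library.Z2" "HOL-Number_Theory.Cong" "Jordan_Normal_Form.Matrix"
begin

text \<open>
  Bit strings of length \<open>n\<close> are identified with the vectors in \<open>carrier_vec n\<close> over the field
  \<open>bit\<close>. Their dot product is an integer rather than a field element, hence the lifting of
  the entries along \<open>of_bit\<close> before multiplying.
\<close>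

definition int_dot :: "bit vec \<Rightarrow> bit vec \<Rightarrow> int" where
  "int_dot x y = map_vec of_bit x \<bullet> map_vec of_bit y"

definition orthogonal_gate :: "nat \<Rightarrow> (bit vec \<Rightarrow> bit vec) \<Rightarrow> bool" where
  "orthogonal_gate n G \<longleftrightarrow>
     bij_betw G (carrier_vec n) (carrier_vec n) \<and>
     (\<forall>x \<in> carrier_vec n. \<forall>y \<in> carrier_vec n. [int_dot (G x) (G y) = int_dot x y] (mod 2))"

end

theory Submission
  imports Defs "Jordan_Normal_Form.Determinant"
begin

text \<open>
  The matrix \<open>A\<close> with columns \<open>G e\<^sub>i\<close> satisfies \<open>A\<^sup>T G x = x\<close> for every \<open>x\<close>, since entry \<open>i\<close> is
  \<open>G e\<^sub>i \<cdot> G x = e\<^sub>i \<cdot> x\<close>. Taking \<open>x = e\<^sub>j\<close> gives \<open>A\<^sup>T A = 1\<close>, hence \<open>A A\<^sup>T = 1\<close>, and therefore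
  \<open>G x = A A\<^sup>T G x = A x\<close>.
\<close>

text \<open>Into \<open>bit\<close>, \<open>of_int\<close> is a ring homomorphism that undoes the
  lift \<open>of_bit\<close> of each entry.\<close>

lemma of_int_int_dot:
  assumes "dim_vec x = dim_vec y"
  shows "of_int (int_dot x y) = x \<bullet> y"
  by (simp add: assms int_dot_def scalar_prod_def Collect_conj_eq Int_assoc)

lemma of_int_bit_eq_if_cong:
  assumes "[a = b] (mod 2)"
  shows "(of_int a :: bit) = of_int b"
proof -
  obtain k where "b = a + 2 * k"
    using assms by (auto simp: cong_iff_lin)
  then show ?thesis
    by simp
qed

lemma orthogonal_gate_carrier:
  assumes "orthogonal_gate n G" "x \<in> carrier_vec n"
  shows "G x \<in> carrier_vec n"
  using assms by (auto simp: orthogonal_gate_def bij_betw_def)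

text \<open>Reducing both integers into \<open>bit\<close> turns the parity condition into an
  identity over a field, where matrix algebra applies.\<close>

lemma orthogonal_gate_scalar_prod:
  assumes "orthogonal_gate n G" "x \<in> carrier_vec n" "y \<in> carrier_vec n"
  shows "G x \<bullet> G y = x \<bullet> y"
proof -
  have "[int_dot (G x) (G y) = int_dot x y] (mod 2)"
    using assms by (auto simp: orthogonal_gate_def)
  from of_int_bit_eq_if_cong[OF this] show ?thesis
    using assms orthogonal_gate_carrier[OF assms(1), THEN carrier_vecD]
    by (simp add: of_int_int_dot)
qed

theorem lemma14:
  fixes n :: nat and G :: "bit vec \<Rightarrow> bit vec"
  assumes "orthogonal_gate n G"
  shows "\<exists>A \<in> carrier_mat n n. invertible_mat A \<and> (\<forall>x \<in> carrier_vec n. G x = A *\<^sub>v x)"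
proof -
  define A where "A = mat_of_cols n (map (\<lambda>i. G (unit_vec n i)) [0..<n])"
  have A: "A \<in> carrier_mat n n"
    by (simp add: A_def mat_of_cols_def)
  have G: "G x \<in> carrier_vec n" if "x \<in> carrier_vec n" for x
    using orthogonal_gate_carrier[OF assms that] .
  have col: "col A i = G (unit_vec n i)" if "i < n" for i
    using that by (simp add: A_def G)
  \<comment> \<open>No linearity of \<open>G\<close> is needed here: each entry only pairs
    \<open>G x\<close> with one column of \<open>A\<close>.\<close>
  have left_inv: "A\<^sup>T *\<^sub>v G x = x" if "x \<in> carrier_vec n" for x
  proof (rule eq_vecI)
    fix i assume "i < dim_vec x"
    with that have "i < n" by simp
    with that A show "(A\<^sup>T *\<^sub>v G x) $ i = x $ i"
      by (simp add: col orthogonal_gate_scalar_prod[OF assms])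
  qed (use A that in simp)
  have AtA: "A\<^sup>T * A = 1\<^sub>m n"
  proof (rule mat_col_eqI)
    fix j assume "j < dim_col (1\<^sub>m n :: bit mat)"
    then have "j < n" by simp
    with A show "col (A\<^sup>T * A) j = col (1\<^sub>m n) j"
      by (simp add: col_mult2[of _ n n _ n] col left_inv)
  qed (use A in simp_all)
  \<comment> \<open>For square matrices over a field, a one-sided inverse is two-sided.\<close>
  then have AAt: "A * A\<^sup>T = 1\<^sub>m n"
    using A by (intro mat_mult_left_right_inverse[of "A\<^sup>T" n A]) auto
  have "invertible_mat A"
    using A AtA AAt by (auto simp: invertible_mat_def inverts_mat_def intro!: exI[of _ "A\<^sup>T"])
  moreover have "G x = A *\<^sub>v x" if "x \<in> carrier_vec n" for x
  proof -
    have "G x = (A * A\<^sup>T) *\<^sub>v G x"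
      using AAt G[OF that] by simp
    also have "\<dots> = A *\<^sub>v (A\<^sup>T *\<^sub>v G x)"
      using A G[OF that] by (simp add: assoc_mult_mat_vec[of _ n n _ n])
    finally show ?thesis
      using left_inv[OF that] by simp
  qed
  ultimately show ?thesis
    using A by blast
qed

end
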